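(* Let $n$ be a positive integer and $m$ an integer. If $n\ge (m-1)(m-2)+2$, then $\Lambda_n\ge m$.
   Context: An $n$-th order Latin Square is an $n\times n$ grid filled with the symbols $1,\dots,n$ such that each symbol appears exactly once in each row and each column. A monotone subsequence is a subsequence that is strictly increasing or strictly decreasing. $\Lambda_n$ is defined as the largest integer such that every $n$-th order Latin Square has a row (read left to right) or a column (read top to bottom) containing a monotone subsequence of length $\Lambda_n$. *)

theory Defs
  imports Main
begin

definition latin_square :: "nat \<Rightarrow> (nat \<Rightarrow> nat \<Rightarrow> nat) \<Rightarrow> bool" where
  "latin_square n L \<longleftrightarrow>
     (\<forall>i\<in>{1..n}. \<forall>j\<in>{1..n}. L i j \<in> {1..n}) \<and>
     (\<forall>i\<in>{1..n}. \<forall>s\<in>{1..n}. \<exists>!j. j \<in> {1..n} \<and> L i j = s) \<and>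
     (\<forall>j\<in>{1..n}. \<forall>s\<in>{1..n}. \<exists>!i. i \<in> {1..n} \<and> L i j = s)"

text \<open>A subsequence of \<open>a 1, \<dots>, a n\<close> is given by its set \<open>S\<close> of positions.\<close>

definition has_monotone_subseq :: "nat \<Rightarrow> (nat \<Rightarrow> nat) \<Rightarrow> nat \<Rightarrow> bool" where
  "has_monotone_subseq n a k \<longleftrightarrow>
     (\<exists>S \<subseteq> {1..n}. card S = k \<and> (strict_mono_on S a \<or> strict_antimono_on S a))"

definition forced_monotone :: "nat \<Rightarrow> nat \<Rightarrow> bool" where
  "forced_monotone n k \<longleftrightarrow>
     (\<forall>L. latin_square n L \<longrightarrow>
        (\<exists>i\<in>{1..n}. has_monotone_subseq n (\<lambda>j. L i j) k) \<or>
        (\<exists>j\<in>{1..n}. has_monotone_subseq n (\<lambda>i. L i j) k))"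

definition Lambda :: "nat \<Rightarrow> nat" where
  "Lambda n = (GREATEST k. forced_monotone n k)"

text \<open>For \<open>n \<ge> 1\<close> the maximum in \<open>Lambda\<close> exists: length \<open>0\<close> is always forced, and since
  there is a Latin square of order \<open>n\<close>, no length above \<open>n\<close> is.\<close>

lemma latin_square_exists: "\<exists>L. latin_square n L"
proof (cases "n = 0")
  case True
  then show ?thesis by (simp add: latin_square_def)
next
  case False
  define L where "L = (\<lambda>i j :: nat. (i + j) mod n + 1)"
  have inj: "j = j'" if "j \<in> {1..n}" "j' \<in> {1..n}" "(i + j) mod n = (i + j') mod n" for i j j'
  proof -
    have "int n dvd int (i + j) - int (i + j')"
      using that(3) by (metis mod_eq_dvd_iff zmod_int)
    then have "int n dvd int j - int j'" by simp
    moreover have "\<bar>int j - int j'\<bar> < int n" using that by auto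
    ultimately have "int j - int j' = 0" by (metis dvd_imp_le_int abs_of_nat not_less)
    then show ?thesis by simp
  qed
  have ex1: "\<exists>!j. j \<in> {1..n} \<and> L i j = s" if "s \<in> {1..n}" for i s
  proof -
    have "inj_on (L i) {1..n}" using inj by (auto simp: L_def inj_on_def)
    moreover have "L i ` {1..n} \<subseteq> {1..n}" using False by (auto simp: L_def Suc_le_eq)
    ultimately have "L i ` {1..n} = {1..n}" by (simp add: endo_inj_surj)
    with that have "s \<in> L i ` {1..n}" by simp
    then obtain j where j: "j \<in> {1..n}" "L i j = s" by (rule imageE) simp
    show ?thesis
    proof (rule ex1I[of _ j])
      show "j \<in> {1..n} \<and> L i j = s" using j by (rule conjI)
      show "j' = j" if "j' \<in> {1..n} \<and> L i j' = s" for j'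
        by (rule inj_onD[OF \<open>inj_on (L i) {1..n}\<close>]) (simp_all only: that j)
    qed
  qed
  have sym: "L i j = L j i" for i j by (simp add: L_def add.commute)
  have rng: "L i j \<in> {1..n}" for i j using False by (simp add: L_def Suc_le_eq)
  have ex1': "\<exists>!i. i \<in> {1..n} \<and> L i j = s" if "s \<in> {1..n}" for j s
    using ex1[OF that, of j] by (simp add: sym[of _ j])
  have "latin_square n L"
    unfolding latin_square_def
    by (intro conjI ballI) (rule rng, (rule ex1, assumption), rule ex1', assumption)
  then show ?thesis by blast
qed

lemma forced_monotone_Lambda:
  assumes "n \<ge> 1"
  shows "forced_monotone n (Lambda n)" and "\<And>k. forced_monotone n k \<Longrightarrow> k \<le> Lambda n"
proof -
  have "has_monotone_subseq n a 0" for a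
    unfolding has_monotone_subseq_def by (intro exI[of _ "{}"]) (simp add: monotone_on_def)
  with assms have 0: "forced_monotone n 0"
    unfolding forced_monotone_def by (auto intro: bexI[of _ 1])
  have "k \<le> n" if "has_monotone_subseq n a k" for a k
  proof -
    from that obtain S where "S \<subseteq> {1..n}" "card S = k"
      unfolding has_monotone_subseq_def by blast
    then show ?thesis using card_mono[of "{1..n}" S] by simp
  qed
  moreover obtain L where "latin_square n L" using latin_square_exists by blast
  ultimately have bd: "\<forall>k. forced_monotone n k \<longrightarrow> k \<le> n"
    unfolding forced_monotone_def by metis
  show "forced_monotone n (Lambda n)"
    unfolding Lambda_def by (rule GreatestI_nat[of "forced_monotone n", OF 0]) (use bd in blast)
  show "k \<le> Lambda n" if "forced_monotone n k" for k
    unfolding Lambda_def by (rule Greatest_le_nat[of "forced_monotone n", OF that]) (use bd in blast)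
qed

end

theory Submission
  imports Defs
begin

text \<open>The symbol \<open>1\<close> opens some row. The other \<open>n - 1\<close> entries of that row are more than
  \<open>(m - 2) * (m - 1)\<close> in number, so by Erdos-Szekeres they contain a decreasing subsequence of
  length \<open>m\<close> or an increasing one of length \<open>m - 1\<close>, which the leading \<open>1\<close> extends.\<close>

text \<open>Induction on \<open>r\<close>: the left-to-right minima \<open>M\<close> form a decreasing subsequence, and an
  increasing subsequence avoiding \<open>M\<close> can be prolonged to the left by an element of \<open>M\<close>.\<close>

lemma Erdos_Szekeres:
  fixes a :: "'a::linorder \<Rightarrow> 'b::linorder"
  assumes "finite A" "inj_on a A" "r * s < card A"
  shows "\<exists>S\<subseteq>A. card S = Suc r \<and> strict_mono_on S a \<or> card S = Suc s \<and> strict_antimono_on S a"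
  using assms
proof (induction r arbitrary: A)
  case 0
  then obtain x where "x \<in> A" by fastforce
  then show ?case by (intro exI[of _ "{x}"]) (simp add: monotone_on_def)
next
  case (Suc r)
  define M where "M = {x \<in> A. \<forall>y\<in>A. y < x \<longrightarrow> a x < a y}"
  have M: "M \<subseteq> A" "strict_antimono_on M a"
    by (auto simp: M_def monotone_on_def)
  show ?case
  proof (cases "s < card M")
    case True
    then obtain S where "S \<subseteq> M" "card S = Suc s"
      by (metis Suc_leI obtain_subset_with_card_n)
    then show ?thesis
      using M by (meson monotone_on_subset subset_trans)
  next
    case False
    have "card (A - M) = card A - card M"
      using M(1) Suc.prems(1) by (meson card_Diff_subset finite_subset)
    \<comment> \<open>Removing at most \<open>s\<close> of more than \<open>Suc r * s\<close>
      elements leaves more than \<open>r * s\<close>.\<close>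
    then have "r * s < card (A - M)"
      using False Suc.prems(3) by simp
    then obtain S where S: "S \<subseteq> A - M"
      "card S = Suc r \<and> strict_mono_on S a \<or> card S = Suc s \<and> strict_antimono_on S a"
      using Suc.IH[of "A - M"] Suc.prems(1,2) by (meson Diff_subset finite_Diff inj_on_subset)
    show ?thesis
    proof (cases "card S = Suc s \<and> strict_antimono_on S a")
      case True
      then show ?thesis using S(1) by blast
    next
      case False
      with S have inc: "card S = Suc r" "strict_mono_on S a" by auto
      have fin: "finite S" using inc(1) card.infinite by fastforce
      define x where "x = Min S"
      have x: "x \<in> S" "\<And>z. z \<in> S \<Longrightarrow> x \<le> z"
        using fin inc(1) by (auto simp: x_def intro!: Min_in)
      \<comment> \<open>Since \<open>x\<close> lies outside \<open>M\<close>, some earlier element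
        has a value at most \<open>a x\<close>, and injectivity makes this strict. Any such
        \<open>y\<close> serves, whether in \<open>M\<close> or not.\<close>
      obtain y where y: "y \<in> A" "y < x" "a y < a x"
      proof -
        from x(1) S(1) obtain y where y: "y \<in> A" "y < x" "\<not> a x < a y"
          unfolding M_def by blast
        moreover have "x \<in> A" using x(1) S(1) by blast
        ultimately have "a y \<noteq> a x"
          using Suc.prems(2) by (metis inj_onD less_irrefl)
        with y that show ?thesis by fastforce
      qed
      have "strict_mono_on (insert y S) a"
      proof (rule strict_mono_onI)
        fix u v assume uv: "u \<in> insert y S" "v \<in> insert y S" "u < v"
        \<comment> \<open>The leftmost element of the increasing \<open>S\<close> also has its least
          value, so \<open>y\<close> lies to the left of and below all of \<open>S\<close>.\<close>
        have "a x \<le> a z" if "z \<in> S" for z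
          using that x inc(2) by (metis order.order_iff_strict strict_mono_onD)
        with uv y x inc(2) show "a u < a v"
          by (metis insert_iff less_le_trans not_less_iff_gr_or_eq order.strict_trans
              strict_mono_onD)
      qed
      moreover have "y \<notin> S" using x(2) y(2) by fastforce
      ultimately show ?thesis
        using S(1) inc(1) fin y(1) by (intro exI[of _ "insert y S"]) auto
    qed
  qed
qed

lemma latin_square_inj_on_row:
  assumes "latin_square n L" "i \<in> {1..n}"
  shows "inj_on (L i) {1..n}"
proof (rule inj_onI)
  fix j j' assume jj: "j \<in> {1..n}" "j' \<in> {1..n}" "L i j = L i j'"
  have "\<forall>i\<in>{1..n}. \<forall>j\<in>{1..n}. L i j \<in> {1..n}"
    and "\<forall>i\<in>{1..n}. \<forall>s\<in>{1..n}. \<exists>!j. j \<in> {1..n} \<and> L i j = s"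
    using assms(1) unfolding latin_square_def by - (elim conjE, assumption)+
  then have "\<exists>!j'. j' \<in> {1..n} \<and> L i j' = L i j"
    using assms(2) jj(1) by (simp only:)
  moreover have "j \<in> {1..n} \<and> L i j = L i j" "j' \<in> {1..n} \<and> L i j' = L i j"
    by (simp_all only: jj)
  ultimately show "j = j'" by (elim ex1E) (iprover intro: trans sym)
qed

text \<open>Here \<open>k\<close> stands for \<open>m - 2\<close>, which keeps subtraction of
  naturals out of the bound. The subsequence is always found in a row; the column condition only
  places the symbol \<open>1\<close> in column \<open>1\<close>.\<close>

lemma forced_monotone_Erdos_Szekeres:
  assumes "k * Suc k + 2 \<le> n"
  shows "forced_monotone n (k + 2)"
  unfolding forced_monotone_def
proof (intro allI impI disjI1)
  fix L assume L: "latin_square n L"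
  have "1 \<in> {1..n}" using assms by simp
  moreover have "\<forall>j\<in>{1..n}. \<forall>s\<in>{1..n}. \<exists>!i. i \<in> {1..n} \<and> L i j = s"
    using L unfolding latin_square_def by (elim conjE)
  ultimately obtain i where i: "i \<in> {1..n}" "L i 1 = 1"
    by (meson ex1_implies_ex)
  have inj: "inj_on (L i) {1..n}"
    using L i(1) by (rule latin_square_inj_on_row)
  have gt: "1 < L i j" if "j \<in> {2..n}" for j
  proof -
    have "L i j \<noteq> L i 1"
      using that inj by (auto dest: inj_onD)
    moreover have "L i j \<in> {1..n}"
      using L i(1) that by (auto simp: latin_square_def)
    ultimately show ?thesis using i(2) by simp
  qed
  \<comment> \<open>The lengths are unequal because position \<open>1\<close> can be put in front of
    an increasing subsequence but not of a decreasing one.\<close>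
  have "\<exists>S\<subseteq>{2..n}. card S = Suc k \<and> strict_mono_on S (L i)
      \<or> card S = Suc (Suc k) \<and> strict_antimono_on S (L i)"
  proof (rule Erdos_Szekeres)
    show "inj_on (L i) {2..n}" using inj by (rule inj_on_subset) simp
    show "k * Suc k < card {2..n}" using assms by simp
  qed simp
  then obtain S where S: "S \<subseteq> {2..n}" and
    "card S = Suc k \<and> strict_mono_on S (L i) \<or> card S = Suc (Suc k) \<and> strict_antimono_on S (L i)"
    by blast
  from this(2) have "has_monotone_subseq n (L i) (k + 2)"
  proof
    assume inc: "card S = Suc k \<and> strict_mono_on S (L i)"
    have "strict_mono_on (insert 1 S) (L i)"
    proof (rule strict_mono_onI)
      fix u v assume uv: "u \<in> insert 1 S" "v \<in> insert 1 S" "u < v"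
      have v: "v \<in> S" using uv S by auto
      show "L i u < L i v"
      proof (cases "u = 1")
        case True
        then show ?thesis using gt v S i(2) by auto
      next
        case False
        then show ?thesis using inc uv v by (auto dest: strict_mono_onD)
      qed
    qed
    moreover have "card (insert 1 S) = k + 2"
      using inc S finite_subset[OF S] by (subst card_insert_disjoint) auto
    moreover have "insert 1 S \<subseteq> {1..n}"
      using S assms by fastforce
    ultimately show ?thesis
      unfolding has_monotone_subseq_def by blast
  next
    assume "card S = Suc (Suc k) \<and> strict_antimono_on S (L i)"
    moreover have "S \<subseteq> {1..n}" using S by fastforce
    ultimately show ?thesis
      unfolding has_monotone_subseq_def by auto
  qed
  then show "\<exists>i\<in>{1..n}. has_monotone_subseq n (\<lambda>j. L i j) (k + 2)"
    using i(1) by blast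
qed

theorem theorem12:
  fixes n :: nat and m :: int
  assumes "n \<ge> 1" and "int n \<ge> (m - 1) * (m - 2) + 2"
  shows "int (Lambda n) \<ge> m"
proof (cases "m \<le> 0")
  case True
  then show ?thesis by simp
next
  case False
  \<comment> \<open>The truncation at \<open>0\<close> treats \<open>m = 1\<close> as \<open>m = 2\<close>, for which the bound on \<open>n\<close> is the same.\<close>
  define k where "k = nat (m - 2)"
  have "int (k * Suc k + 2) = (m - 1) * (m - 2) + 2"
  proof (cases "m = 1")
    case True
    then show ?thesis by (simp add: k_def)
  next
    case m: False
    then have "m = int k + 2" using False by (simp add: k_def)
    then show ?thesis by (simp add: algebra_simps)
  qed
  then have "k * Suc k + 2 \<le> n" using assms(2) by linarith
  then have "k + 2 \<le> Lambda n"
    by (intro forced_monotone_Lambda(2)[OF assms(1)] forced_monotone_Erdos_Szekeres)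
  \<comment> \<open>Truncation only helps here: \<open>k + 2\<close> is \<open>m\<close>, or
    \<open>2\<close> when \<open>m = 1\<close>.\<close>
  then show ?thesis by (simp add: k_def)
qed

end
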